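(* Let $M:(-1,1)\to(0,\infty)$ be a measurable function with $$\int_{-1}^{1}\log^+\log^+ M(y)\,dy<\infty .$$ Write $\mathbb{R}^n=\{(x,y): x\in\mathbb{R}^{n-1},\ y\in\mathbb{R}\}$, let $\Omega\subset B_1(0)\subset\mathbb{R}^n$ be a domain, and let $P$ be a differential operator in $\Omega$. Let $L_M$ be the family of all functions $u$ in $\Omega$ that satisfy the differential equation $Pu=0$ in $\Omega$ and the inequality $|u(x,y)|\le M(y)$ for all $(x,y)\in\Omega$. Then: (A) If the version of the three balls inequality for wild sets (SQUCP) holds for solutions of $Pu=0$ in $\Omega$, then $L_M$ is uniformly bounded on every compact subset of $\Omega$; that is, for every compact $K\subset\Omega$, $\sup_{u\in L_M}\sup_{K}|u|<\infty$. (B) If the three balls inequality holds for solutions of $Pu=0$ in $\Omega$, and if additionally $M$ is symmetric, $M(y)=M(|y|)$ for all $y\in(-1,1)$, and monotonically decreasing on $(0,1)$, then $L_M$ is uniformly bounded on every compact subset of $\Omega$ (in the same sense).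
   Context: Notation: $\log^+(x)=\log x$ for $x\ge 1$ and $\log^+(x)=0$ for $x\le 1$. $B_r(p)$ is the open ball in $\mathbb{R}^n$ of radius $r$ centered at $p$. For a ball $B$ and $k>0$, $kB$ is the ball with the same center as $B$ and $k$ times its radius. $|S|$ denotes the $n$-dimensional Lebesgue measure of $S$. A domain is a nonempty open connected set. Solutions $u$ of $Pu=0$ are continuous functions in $\Omega$. Three balls inequality: we say that it holds for solutions of $Pu=0$ in a bounded domain $\Omega\subset\mathbb{R}^n$ if there are constants $C>0$ and $\alpha\in(0,1)$, depending on $P$ and $\Omega$ only, such that $$\sup_B|u|\le C\Big(\sup_{\frac12 B}|u|\Big)^{\alpha}\Big(\sup_{2B}|u|\Big)^{1-\alpha}$$ for every ball $B$ with $2B\subset\Omega$ and every solution $u$ of $Pu=0$ in $\Omega$. Version of the three balls inequality for wild sets (strong quantitative unique continuation property, SQUCP): we say that it holds for solutions of $Pu=0$ in a bounded domain $\Omega\subset\mathbb{R}^n$ if there are constants $c\in(0,1)$, $C>0$ and $\alpha\in(0,1)$ such that for every ball $B$ with $2B\subset\Omega$ and every measurable subset $S\subset B$ with $|S|>c|B|$, $$\sup_B|u|\le C\Big(\sup_{S}|u|\Big)^{\alpha}\Big(\sup_{2B}|u|\Big)^{1-\alpha}$$ for every solution $u$ of $Pu=0$ in $\Omega$. In both definitions the inequality is regarded as satisfied when $\sup_{2B}|u|=+\infty$. *)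

theory Defs
  imports "HOL-Analysis.Analysis"
begin

definition domain :: "'a::real_normed_vector set \<Rightarrow> bool" where
  "domain \<Omega> \<longleftrightarrow> \<Omega> \<noteq> {} \<and> open \<Omega> \<and> connected \<Omega>"

definition log_plus :: "real \<Rightarrow> real" where
  "log_plus x = (if x \<ge> 1 then ln x else 0)"

subsection \<open>Derivatives\<close>

definition partial :: "'n \<Rightarrow> (real^'n \<Rightarrow> 'b::real_normed_vector) \<Rightarrow> real^'n \<Rightarrow> 'b" where
  "partial i f x = vector_derivative (\<lambda>t. f (x + t *\<^sub>R axis i 1)) (at 0)"

text \<open>Iterated derivatives are indexed by words in the coordinate directions rather than by
  multi-indices: the word [i, j] stands for the i-th partial derivative of the j-th one, and its
  length is the order. On functions of class C^k a word of length at most k acts as the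
  multi-index counting its letters.\<close>

primrec partials :: "'n list \<Rightarrow> (real^'n \<Rightarrow> 'b::real_normed_vector) \<Rightarrow> real^'n \<Rightarrow> 'b" where
  "partials [] f = f"
| "partials (i # w) f = partial i (partials w f)"

primrec has_partials :: "'n list \<Rightarrow> (real^'n) set \<Rightarrow> (real^'n \<Rightarrow> 'b::real_normed_vector) \<Rightarrow> bool" where
  "has_partials [] S f \<longleftrightarrow> True"
| "has_partials (i # w) S f \<longleftrightarrow> has_partials w S f \<and>
     (\<forall>x\<in>S. (\<lambda>t. partials w f (x + t *\<^sub>R axis i 1)) differentiable (at 0))"

definition class_C :: "nat \<Rightarrow> (real^'n) set \<Rightarrow> (real^'n \<Rightarrow> 'b::real_normed_vector) \<Rightarrow> bool" where
  "class_C k S f \<longleftrightarrow>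
     (\<forall>w. length w \<le> k \<longrightarrow> has_partials w S f \<and> continuous_on S (partials w f))"

definition test_function :: "(real^'n) set \<Rightarrow> (real^'n \<Rightarrow> real) \<Rightarrow> bool" where
  "test_function \<Omega> \<phi> \<longleftrightarrow> (\<forall>k. class_C k UNIV \<phi>) \<and>
     (\<exists>K. compact K \<and> K \<subseteq> \<Omega> \<and> (\<forall>x. x \<notin> K \<longrightarrow> \<phi> x = 0))"

definition locally_integrable ::
  "(real^'n) set \<Rightarrow> (real^'n \<Rightarrow> 'b::euclidean_space) \<Rightarrow> bool" where
  "locally_integrable \<Omega> f \<longleftrightarrow>
     (\<forall>K. compact K \<longrightarrow> K \<subseteq> \<Omega> \<longrightarrow> set_integrable lebesgue K f)"

definition weak_partials ::
  "'n list \<Rightarrow> (real^'n) set \<Rightarrow> (real^'n \<Rightarrow> 'b::euclidean_space) \<Rightarrow> (real^'n \<Rightarrow> 'b) \<Rightarrow> bool" where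
  "weak_partials w \<Omega> u g \<longleftrightarrow> locally_integrable \<Omega> u \<and> locally_integrable \<Omega> g \<and>
     (\<forall>\<phi>. test_function \<Omega> \<phi> \<longrightarrow>
        (LINT x:\<Omega>|lebesgue. partials (rev w) \<phi> x *\<^sub>R u x) =
        (-1) ^ length w *\<^sub>R (LINT x:\<Omega>|lebesgue. \<phi> x *\<^sub>R g x))"

subsection \<open>Differential operators and their solutions\<close>

text \<open>A scalar differential operator is an expression
    (P u)(x) = sum over v with length v at most the outer order of
               partials v (flux v x (jet of u at x)),
  where the jet consists of the derivatives of u of order up to the inner order.
  Outer order 0 gives the operators F(x, derivatives of u), in particular the linear ones
  (flux [] x j is the sum of a w x * j w over the words w up to the inner order). Positive outer
  order gives operators in divergence form, whose coefficients need not be differentiable.\<close>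

record ('n, 'k) diff_operator =
  outer_order :: nat
  inner_order :: nat
  flux :: "'n list \<Rightarrow> real^'n \<Rightarrow> ('n list \<Rightarrow> 'k) \<Rightarrow> 'k"

definition flux_of :: "('n, 'k::zero) diff_operator \<Rightarrow> 'n list \<Rightarrow>
    ('n list \<Rightarrow> real^'n \<Rightarrow> 'k) \<Rightarrow> real^'n \<Rightarrow> 'k" where
  "flux_of P v g x = flux P v x (\<lambda>w. if length w \<le> inner_order P then g w x else 0)"

definition classical_solution :: "('n, 'k::real_normed_vector) diff_operator \<Rightarrow>
    (real^'n) set \<Rightarrow> (real^'n \<Rightarrow> 'k) \<Rightarrow> bool" where
  "classical_solution P \<Omega> u \<longleftrightarrow> class_C (inner_order P) \<Omega> u \<and>
     (\<forall>v. length v \<le> outer_order P \<longrightarrow> has_partials v \<Omega> (flux_of P v (\<lambda>w. partials w u))) \<and>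
     (\<forall>x\<in>\<Omega>. (\<Sum>v | length v \<le> outer_order P.
         partials v (flux_of P v (\<lambda>w. partials w u)) x) = 0)"

text \<open>The weak derivatives entering P are required to be locally in L^p, with p at least 1
  intended. For p = 1 this adds nothing to the definition of weak derivatives (with inner order
  0 one gets distributional solutions); p = 2 gives energy solutions.\<close>

definition weak_solution :: "real \<Rightarrow> ('n, 'k::euclidean_space) diff_operator \<Rightarrow>
    (real^'n) set \<Rightarrow> (real^'n \<Rightarrow> 'k) \<Rightarrow> bool" where
  "weak_solution p P \<Omega> u \<longleftrightarrow> (\<exists>g.
     (\<forall>w. length w \<le> inner_order P \<longrightarrow>
        weak_partials w \<Omega> u (g w) \<and> locally_integrable \<Omega> (\<lambda>x. norm (g w x) powr p)) \<and>
     (\<forall>v. length v \<le> outer_order P \<longrightarrow> locally_integrable \<Omega> (flux_of P v g)) \<and>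
     (\<forall>\<phi>. test_function \<Omega> \<phi> \<longrightarrow>
        (\<Sum>v | length v \<le> outer_order P.
           (-1) ^ length v *\<^sub>R
             (LINT x:\<Omega>|lebesgue. partials (rev v) \<phi> x *\<^sub>R flux_of P v g x)) = 0))"

datatype solution_sense = Classical | Weak real

definition solution :: "solution_sense \<Rightarrow> ('n, 'k::euclidean_space) diff_operator \<Rightarrow>
    (real^'n) set \<Rightarrow> (real^'n \<Rightarrow> 'k) \<Rightarrow> bool" where
  "solution s P \<Omega> u \<longleftrightarrow> continuous_on \<Omega> u \<and>
     (case s of Classical \<Rightarrow> classical_solution P \<Omega> u | Weak p \<Rightarrow> weak_solution p P \<Omega> u)"

subsection \<open>Three balls inequalities\<close>

text \<open>The boundedness hypothesis on the double ball implements the convention that the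
  inequalities count as satisfied when the supremum over that ball is infinite; it makes all real
  suprema below suprema of nonempty bounded sets.\<close>

definition three_balls_inequality :: "solution_sense \<Rightarrow> ('n::finite, 'k::euclidean_space) diff_operator \<Rightarrow>
    (real^'n) set \<Rightarrow> bool" where
  "three_balls_inequality s P \<Omega> \<longleftrightarrow> (\<exists>C \<alpha>. C > 0 \<and> 0 < \<alpha> \<and> \<alpha> < 1 \<and>
     (\<forall>p r u. r > 0 \<longrightarrow> ball p (2 * r) \<subseteq> \<Omega> \<longrightarrow> solution s P \<Omega> u \<longrightarrow>
        bounded (u ` ball p (2 * r)) \<longrightarrow>
        (SUP x\<in>ball p r. norm (u x)) \<le>
          C * (SUP x\<in>ball p (r / 2). norm (u x)) powr \<alpha> *
          (SUP x\<in>ball p (2 * r). norm (u x)) powr (1 - \<alpha>)))"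

definition SQUCP :: "solution_sense \<Rightarrow> ('n::finite, 'k::euclidean_space) diff_operator \<Rightarrow>
    (real^'n) set \<Rightarrow> bool" where
  "SQUCP s P \<Omega> \<longleftrightarrow> (\<exists>c C \<alpha>. 0 < c \<and> c < 1 \<and> C > 0 \<and> 0 < \<alpha> \<and> \<alpha> < 1 \<and>
     (\<forall>p r S u. r > 0 \<longrightarrow> ball p (2 * r) \<subseteq> \<Omega> \<longrightarrow>
        S \<in> sets lebesgue \<longrightarrow> S \<subseteq> ball p r \<longrightarrow>
        measure lebesgue S > c * measure lebesgue (ball p r) \<longrightarrow>
        solution s P \<Omega> u \<longrightarrow> bounded (u ` ball p (2 * r)) \<longrightarrow>
        (SUP x\<in>ball p r. norm (u x)) \<le>
          C * (SUP x\<in>S. norm (u x)) powr \<alpha> *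
          (SUP x\<in>ball p (2 * r). norm (u x)) powr (1 - \<alpha>)))"

subsection \<open>The family of solutions with a given majorant\<close>

text \<open>The coordinate direction l plays the role of y in the splitting (x, y).\<close>

definition L_family :: "solution_sense \<Rightarrow> ('n, 'k::euclidean_space) diff_operator \<Rightarrow>
    (real^'n) set \<Rightarrow> 'n \<Rightarrow> (real \<Rightarrow> real) \<Rightarrow> (real^'n \<Rightarrow> 'k) set" where
  "L_family s P \<Omega> l M = {u. solution s P \<Omega> u \<and> (\<forall>z\<in>\<Omega>. norm (u z) \<le> M (z $ l))}"

definition uniformly_bounded_on_compacts ::
  "'a::topological_space set \<Rightarrow> ('a \<Rightarrow> 'b::real_normed_vector) set \<Rightarrow> bool" where
  "uniformly_bounded_on_compacts \<Omega> F \<longleftrightarrow>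
     (\<forall>K. compact K \<longrightarrow> K \<subseteq> \<Omega> \<longrightarrow> (\<exists>A. \<forall>u\<in>F. \<forall>x\<in>K. norm (u x) \<le> A))"

end

theory Submission
  imports Defs
begin

text \<open>Suppose a solution has norm at least exp T at p. If it is at most exp (T/2) on
  the set S (the half ball, or the wild set) of a three balls inequality around p, then that
  inequality forces a value exp ((1 + alpha/2) T) on the double ball, provided T is large: the logarithm of the solution
  has grown by the fixed factor kappa = 1 + alpha/2 (growth_from_interpolation).

  Iterating, one obtains points p_0, p_1, ... at which the solution is at least
  exp (2 kappa^k). The step from p_k only needs a radius rho_k larger than a constant times
  mu_k, the length of the set of heights y with M y > exp (kappa^k). Indeed, a solution
  majorized by M is at most exp (kappa^k) off the slab over this short set of heights. In (A) the
  slab covers only a small proportion of a ball of radius comparable to rho_k. In (B) the set of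
  heights is, up to the point 0, an interval centred at 0, so that one can place a ball that
  contains p_k and whose half ball lies outside the slab.

  The condition M y > exp (kappa^k) says that k ln kappa < log log M y. Hence the sum of the
  mu_k is at most the integral of 1 + log^+ log^+ M / ln kappa, and is finite. This is where the
  double logarithm comes from (summable_superlevel_lengths). If the chain starts at a late
  index k, its total length is less than a fixed d such that the balls of radius d about the
  points of the given compact set lie in the domain, so the chain stays in a compact
  subset of the domain while the solution blows up along it, contradicting continuity (uniformly_bounded_if_values_propagate).\<close>

section \<open>Propagation of large values\<close>

text \<open>Since the radius of the k-th step is the same for all solutions and all points, the tails of
  the series of radii control how far a chain that starts at a late index can travel.\<close>

lemma uniformly_bounded_if_values_propagate:
  fixes \<Omega> :: "'a::heine_borel set" and F :: "('a \<Rightarrow> 'b::real_normed_vector) set"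
    and \<rho> h :: "nat \<Rightarrow> real"
  assumes "open \<Omega>" and cont: "\<And>u. u \<in> F \<Longrightarrow> continuous_on \<Omega> u"
    and \<rho>: "summable \<rho>" "\<And>k. 0 \<le> \<rho> k"
    and h: "filterlim h at_top sequentially"
    and step: "\<And>u p k. u \<in> F \<Longrightarrow> k0 \<le> k \<Longrightarrow> cball p (\<rho> k) \<subseteq> \<Omega> \<Longrightarrow> h k \<le> norm (u p)
      \<Longrightarrow> \<exists>q\<in>ball p (\<rho> k). h (Suc k) \<le> norm (u q)"
  shows "uniformly_bounded_on_compacts \<Omega> F"
  unfolding uniformly_bounded_on_compacts_def
proof (intro allI impI)
  fix K assume K: "compact K" "K \<subseteq> \<Omega>"
  obtain d where d: "d > 0" "(\<Union>x\<in>K. cball x d) \<subseteq> \<Omega>"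
    using compact_subset_open_imp_cball_epsilon_subset[OF K(1) \<open>open \<Omega>\<close> K(2)] by blast
  obtain N1 where N1: "\<And>n. n \<ge> N1 \<Longrightarrow> norm (\<Sum>i. \<rho> (i + n)) < d"
    using suminf_exist_split[OF d(1) \<rho>(1)] by blast
  define N where "N = max N1 k0"
  have tail: "(\<Sum>i<j. \<rho> (i + N)) < d" for j
  proof -
    have "(\<Sum>i<j. \<rho> (i + N)) \<le> (\<Sum>i. \<rho> (i + N))"
      using \<rho> by (intro sum_le_suminf) (auto simp: summable_iff_shift)
    also have "\<dots> \<le> norm (\<Sum>i. \<rho> (i + N))" by simp
    also have "\<dots> < d" using N1[of N] by (simp add: N_def)
    finally show ?thesis .
  qed
  have "norm (u x) \<le> h N" if u: "u \<in> F" and x: "x \<in> K" for u x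
  proof (rule ccontr)
    assume "\<not> norm (u x) \<le> h N"
    then have large: "h N \<le> norm (u x)" by simp
    have xd: "cball x d \<subseteq> \<Omega>" using d x by blast
    have chain: "\<exists>q. dist x q \<le> (\<Sum>i<j. \<rho> (i + N)) \<and> h (j + N) \<le> norm (u q)" for j
    proof (induction j)
      case 0
      show ?case using large by (intro exI[of _ x]) simp
    next
      case (Suc j)
      then obtain q where q: "dist x q \<le> (\<Sum>i<j. \<rho> (i + N))" "h (j + N) \<le> norm (u q)" by blast
      have "cball q (\<rho> (j + N)) \<subseteq> cball x d"
      proof
        fix z assume "z \<in> cball q (\<rho> (j + N))"
        then have "dist x z \<le> (\<Sum>i<Suc j. \<rho> (i + N))"
          using q(1) dist_triangle[of x z q] by simp
        also have "\<dots> < d" by (rule tail)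
        finally show "z \<in> cball x d" by simp
      qed
      moreover have "k0 \<le> j + N" by (simp add: N_def)
      ultimately obtain z where z: "z \<in> ball q (\<rho> (j + N))" "h (Suc (j + N)) \<le> norm (u z)"
        using step[OF u, of "j + N" q] q(2) xd by blast
      have "dist x z \<le> (\<Sum>i<Suc j. \<rho> (i + N))"
        using q(1) z(1) dist_triangle[of x z q] by simp
      then show ?case using z(2) by auto
    qed
    have "compact (u ` cball x d)"
      using continuous_on_subset[OF cont[OF u] xd] by (intro compact_continuous_image) auto
    then obtain A where A: "\<And>z. z \<in> cball x d \<Longrightarrow> norm (u z) \<le> A"
      using compact_imp_bounded bounded_iff by (metis imageI)
    have "eventually (\<lambda>j. h j > A) sequentially"
      using h by (simp add: filterlim_at_top_dense)
    then obtain J where J: "\<And>j. j \<ge> J \<Longrightarrow> h j > A" by (auto simp: eventually_sequentially)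
    obtain q where q: "dist x q \<le> (\<Sum>i<J. \<rho> (i + N))" "h (J + N) \<le> norm (u q)"
      using chain[of J] by blast
    then have "norm (u q) \<le> A" using tail[of J] by (intro A) simp
    then show False using q(2) J[of "J + N"] by simp
  qed
  then show "\<exists>A. \<forall>u\<in>F. \<forall>x\<in>K. norm (u x) \<le> A" by blast
qed

text \<open>If all values on D were below exp ((1 + alpha/2) T), the interpolation inequality would
  bound exp T by C times the exponential of
  alpha (T/2) + (1 - alpha) (1 + alpha/2) T = T - alpha^2 T / 2.\<close>

lemma growth_from_interpolation:
  fixes u :: "'a \<Rightarrow> 'b::real_normed_vector"
  assumes \<alpha>: "0 < \<alpha>" "\<alpha> < 1" and C: "0 < C" and T: "2 * ln C < \<alpha>\<^sup>2 * T"
    and sub: "B \<subseteq> D" "S \<subseteq> D" "S \<noteq> {}" and bdd: "bounded (u ` D)"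
    and small: "\<And>x. x \<in> S \<Longrightarrow> norm (u x) \<le> exp (T / 2)"
    and p: "p \<in> B" "exp T \<le> norm (u p)"
    and interp: "(SUP x\<in>B. norm (u x)) \<le>
      C * (SUP x\<in>S. norm (u x)) powr \<alpha> * (SUP x\<in>D. norm (u x)) powr (1 - \<alpha>)"
  shows "\<exists>q\<in>D. exp ((1 + \<alpha> / 2) * T) \<le> norm (u q)"
proof (rule ccontr)
  assume "\<not> ?thesis"
  then have le: "\<And>q. q \<in> D \<Longrightarrow> norm (u q) \<le> exp ((1 + \<alpha> / 2) * T)" by force
  have bddD: "bdd_above ((\<lambda>x. norm (u x)) ` D)"
    using le by (auto simp: bdd_above_def)
  have bddS: "bdd_above ((\<lambda>x. norm (u x)) ` S)" and bddB: "bdd_above ((\<lambda>x. norm (u x)) ` B)"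
    using bddD sub by (meson bdd_above_mono image_mono)+
  have pos: "0 \<le> (SUP x\<in>X. norm (u x))"
    if "bdd_above ((\<lambda>x. norm (u x)) ` X)" "X \<noteq> {}" for X
    using that cSUP_upper2[of "\<lambda>x. norm (u x)" X _ 0] by (metis ex_in_conv norm_ge_zero)
  have D: "(SUP x\<in>D. norm (u x)) \<le> exp ((1 + \<alpha> / 2) * T)"
    using sub le by (intro cSUP_least) auto
  have S: "(SUP x\<in>S. norm (u x)) \<le> exp (T / 2)"
    using sub small by (intro cSUP_least) auto
  have "exp T \<le> (SUP x\<in>B. norm (u x))"
    using p cSUP_upper[OF p(1) bddB] by simp
  also have "\<dots> \<le> C * (SUP x\<in>S. norm (u x)) powr \<alpha> * (SUP x\<in>D. norm (u x)) powr (1 - \<alpha>)"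
    by (fact interp)
  also have "\<dots> \<le> C * exp (T / 2) powr \<alpha> * exp ((1 + \<alpha> / 2) * T) powr (1 - \<alpha>)"
    using S D sub C \<alpha> pos[OF bddS] pos[OF bddD]
    by (intro mult_mono powr_mono2) auto
  also have "\<dots> = exp (ln C + \<alpha> * (T / 2) + (1 - \<alpha>) * ((1 + \<alpha> / 2) * T))"
    using C by (simp add: exp_add powr_def)
  also have "\<dots> = exp (T + (ln C - \<alpha>\<^sup>2 * T / 2))"
    by (rule arg_cong[of _ _ exp]) (simp add: field_simps power2_eq_square)
  finally show False using T by simp
qed

section \<open>The lengths of the superlevel sets of the majorant\<close>

lemma superlevel_in_lebesgue:
  fixes M :: "real \<Rightarrow> real"
  assumes "M \<in> borel_measurable (lebesgue_on {-1<..<1})"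
  shows "{y\<in>{-1<..<1}. m < M y} \<in> sets (lebesgue_on {-1<..<1})"
    and "{y\<in>{-1<..<1}. m < M y} \<in> lmeasurable"
proof -
  have "{y\<in>space (lebesgue_on {-1<..<1}). m < M y} \<in> sets (lebesgue_on {-1<..<1})"
    using assms by measurable
  then show *: "{y\<in>{-1<..<1}. m < M y} \<in> sets (lebesgue_on {-1<..<1})"
    by simp
  have "{y\<in>{-1<..<1}. m < M y} \<in> sets lebesgue"
    using * by (simp add: sets_restrict_space_iff)
  moreover have "bounded {y\<in>{-1<..<1}. m < M y}"
    by (rule bounded_subset[of "{-1<..<1}"]) auto
  ultimately show "{y\<in>{-1<..<1}. m < M y} \<in> lmeasurable"
    by (rule bounded_set_imp_lmeasurable[rotated])
qed

lemma exp_power_less_imp_log_plus: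
  assumes "1 < \<kappa>" "exp (\<kappa> ^ k) < m"
  shows "real k * ln \<kappa> < log_plus (log_plus m)"
proof -
  have "1 \<le> \<kappa> ^ k" using assms by simp
  moreover have "1 < m" using assms(2) \<open>1 \<le> \<kappa> ^ k\<close> by (smt (verit) one_less_exp_iff)
  moreover have "\<kappa> ^ k < ln m" using assms(2) \<open>1 < m\<close> ln_less_cancel_iff[of "exp (\<kappa> ^ k)" m] by simp
  moreover from this have "1 \<le> ln m" using \<open>1 \<le> \<kappa> ^ k\<close> by linarith
  moreover from \<open>\<kappa> ^ k < ln m\<close> have "ln (\<kappa> ^ k) < ln (ln m)"
    using \<open>1 \<le> \<kappa> ^ k\<close> by (subst ln_less_cancel_iff) auto
  ultimately show ?thesis using assms(1) by (simp add: log_plus_def ln_realpow)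
qed

text \<open>At a point y the inequality exp (kappa^k) < M y holds for at most
  1 + log^+ log^+ M y / ln kappa indices k; integrate this count.\<close>

lemma summable_superlevel_lengths:
  fixes M :: "real \<Rightarrow> real"
  assumes M_meas: "M \<in> borel_measurable (lebesgue_on {-1<..<1})"
    and M_int: "(\<integral>\<^sup>+ y. ennreal (log_plus (log_plus (M y))) \<partial>lebesgue_on {-1<..<1}) < \<infinity>"
    and \<kappa>: "1 < \<kappa>"
  shows "summable (\<lambda>k. measure lebesgue {y\<in>{-1<..<1}. exp (\<kappa> ^ k) < M y})"
proof -
  let ?I = "{-1<..<1::real}" and ?L = "lebesgue_on {-1<..<1::real}"
  define g where "g = (\<lambda>y. log_plus (log_plus (M y)))"
  have lp[measurable]: "log_plus \<in> borel_measurable borel"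
    unfolding log_plus_def[abs_def] by measurable
  have lp0: "0 \<le> log_plus x" for x by (simp add: log_plus_def)
  note M_meas[measurable]
  have gm: "g \<in> borel_measurable ?L" unfolding g_def by measurable
  have gi: "integrable ?L g"
    using M_int gm lp0 by (intro integrableI_nonneg) (auto simp: g_def)
  have one: "integrable ?L (\<lambda>y. 1::real)"
    by (simp add: integrable_restrict_space set_integrable_def[symmetric])
  let ?E = "\<lambda>k. {y\<in>?I. exp (\<kappa> ^ k) < M y}"
  note E = superlevel_in_lebesgue[OF M_meas]
  have Ei: "integrable ?L (indicat_real (?E k))" for k
    by (rule Bochner_Integration.integrable_bound[OF one])
       (use E in \<open>auto simp: indicator_def\<close>)
  have count: "(\<Sum>k<n. indicat_real (?E k) y) \<le> g y / ln \<kappa> + 1" for n y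
  proof -
    let ?J = "{k\<in>{..<n}. y \<in> ?E k}"
    have "?J \<subseteq> {..<nat \<lceil>g y / ln \<kappa>\<rceil>}"
    proof
      fix k assume "k \<in> ?J"
      then have "real k * ln \<kappa> < g y"
        using exp_power_less_imp_log_plus[OF \<kappa>] by (simp add: g_def)
      then have "real k < g y / ln \<kappa>" using \<kappa> by (simp add: field_simps)
      then show "k \<in> {..<nat \<lceil>g y / ln \<kappa>\<rceil>}" by (simp add: zless_nat_eq_int_zless less_ceiling_iff)
    qed
    then have "card ?J \<le> nat \<lceil>g y / ln \<kappa>\<rceil>"
      using card_mono[of "{..<nat \<lceil>g y / ln \<kappa>\<rceil>}" ?J] by simp
    moreover have "0 \<le> g y / ln \<kappa>" using lp0 \<kappa> by (simp add: g_def)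
    ultimately have "real (card ?J) \<le> g y / ln \<kappa> + 1" by linarith
    moreover have "(\<Sum>k<n. indicat_real (?E k) y) = real (card ?J)"
    proof -
      have "real (card ?J) = (\<Sum>k<n. if y \<in> ?E k then 1 else 0)"
        by (subst sum.inter_filter[symmetric]) simp_all
      then show ?thesis by (simp only: indicator_def of_bool_def)
    qed
    ultimately show ?thesis by simp
  qed
  have meas: "integral\<^sup>L ?L (indicat_real (?E k)) = measure lebesgue (?E k)" for k
  proof -
    have "?E k \<inter> ?I = ?E k" by blast
    then have "integral\<^sup>L ?L (indicat_real (?E k)) = measure ?L (?E k)" by simp
    also have "\<dots> = measure lebesgue (?E k)"
      by (rule measure_restrict_space) auto
    finally show ?thesis .
  qed
  show ?thesis
  proof (rule summableI_nonneg_bounded)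
    fix n
    have "(\<Sum>k<n. measure lebesgue (?E k)) = (\<integral>y. (\<Sum>k<n. indicat_real (?E k) y) \<partial>?L)"
      by (subst Bochner_Integration.integral_sum) (use Ei in blast, simp only: meas)
    also have "\<dots> \<le> (\<integral>y. g y / ln \<kappa> + 1 \<partial>?L)"
      using Ei gi one count by (intro integral_mono) auto
    finally show "(\<Sum>k<n. measure lebesgue (?E k)) \<le> (\<integral>y. g y / ln \<kappa> + 1 \<partial>?L)" .
  qed simp
qed

section \<open>The majorant principle\<close>

text \<open>The common core of (A) and (B). The two three balls inequalities differ in the sets S that
  they allow; in both cases an S on which the solution is at most a given level m exists as soon as
  the radius available at p exceeds a constant times the length of the superlevel set of M at m.
  With m = exp (kappa^k) this distance is summable in k, while growth_from_interpolation gives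
  the step from exp (2 kappa^k) to exp (2 kappa^(k+1)).\<close>

lemma uniformly_bounded_if_interpolation_off_superlevel:
  fixes \<Omega> :: "'a::heine_borel set" and F :: "('a \<Rightarrow> 'b::real_normed_vector) set"
    and M :: "real \<Rightarrow> real"
  assumes "open \<Omega>" and cont: "\<And>u. u \<in> F \<Longrightarrow> continuous_on \<Omega> u"
    and M_meas: "M \<in> borel_measurable (lebesgue_on {-1<..<1})"
    and M_int: "(\<integral>\<^sup>+ y. ennreal (log_plus (log_plus (M y))) \<partial>lebesgue_on {-1<..<1}) < \<infinity>"
    and \<alpha>: "0 < \<alpha>" "\<alpha> < 1" and C: "0 < C" and A: "0 \<le> A"
    and interp: "\<And>u p m \<rho>. u \<in> F \<Longrightarrow> A * measure lebesgue {y\<in>{-1<..<1}. m < M y} < \<rho> \<Longrightarrow>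
      cball p \<rho> \<subseteq> \<Omega> \<Longrightarrow> \<exists>B S D. p \<in> B \<and> B \<subseteq> D \<and> S \<subseteq> D \<and> S \<noteq> {} \<and> D \<subseteq> ball p \<rho> \<and>
        (\<forall>x\<in>S. norm (u x) \<le> m) \<and>
        (bounded (u ` D) \<longrightarrow> (SUP x\<in>B. norm (u x)) \<le>
          C * (SUP x\<in>S. norm (u x)) powr \<alpha> * (SUP x\<in>D. norm (u x)) powr (1 - \<alpha>))"
  shows "uniformly_bounded_on_compacts \<Omega> F"
proof -
  define \<kappa> where "\<kappa> = 1 + \<alpha> / 2"
  have \<kappa>: "1 < \<kappa>" using \<alpha> by (simp add: \<kappa>_def)
  define \<mu> where "\<mu> = (\<lambda>k. measure lebesgue {y\<in>{-1<..<1}. exp (\<kappa> ^ k) < M y})"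
  \<comment> \<open>The summand (1/2)^k makes the radius strictly larger than the required multiple of the
    length, which may be 0.\<close>
  define \<rho> where "\<rho> = (\<lambda>k. A * \<mu> k + (1 / 2) ^ k)"
  have "summable \<mu>"
    unfolding \<mu>_def by (rule summable_superlevel_lengths[OF M_meas M_int \<kappa>])
  then have "summable \<rho>"
    unfolding \<rho>_def by (intro summable_add summable_mult summable_geometric) auto
  have \<kappa>_lim: "filterlim (\<lambda>k. \<kappa> ^ k) at_top sequentially"
    using \<kappa> by (intro filterlim_at_infinity_imp_filterlim_at_top
      filterlim_realpow_sequentially_gt1) auto
  then have "eventually (\<lambda>k. ln C / \<alpha>\<^sup>2 < \<kappa> ^ k) sequentially"
    by (simp add: filterlim_at_top_dense)
  then obtain k0 where k0: "\<And>k. k \<ge> k0 \<Longrightarrow> ln C / \<alpha>\<^sup>2 < \<kappa> ^ k"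
    by (auto simp: eventually_sequentially)
  show ?thesis
  proof (rule uniformly_bounded_if_values_propagate[OF \<open>open \<Omega>\<close> cont \<open>summable \<rho>\<close>])
    show "0 \<le> \<rho> k" for k using A by (simp add: \<rho>_def \<mu>_def)
    have "filterlim (\<lambda>k. 2 * \<kappa> ^ k) at_top sequentially"
      by (intro filterlim_tendsto_pos_mult_at_top[OF tendsto_const _ \<kappa>_lim]) simp
    then show "filterlim (\<lambda>k. exp (2 * \<kappa> ^ k)) at_top sequentially"
      by (rule filterlim_compose[OF exp_at_top])
  next
    fix u p k assume u: "u \<in> F" and k: "k0 \<le> k" and p: "cball p (\<rho> k) \<subseteq> \<Omega>"
      "exp (2 * \<kappa> ^ k) \<le> norm (u p)"
    have "A * measure lebesgue {y\<in>{-1<..<1}. exp (\<kappa> ^ k) < M y} < \<rho> k"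
      by (simp add: \<rho>_def \<mu>_def)
    from interp[OF u this p(1)] obtain B S D where
      *: "p \<in> B" "B \<subseteq> D" "S \<subseteq> D" "S \<noteq> {}" "D \<subseteq> ball p (\<rho> k)"
         "\<And>x. x \<in> S \<Longrightarrow> norm (u x) \<le> exp (\<kappa> ^ k)" and
      ineq: "bounded (u ` D) \<Longrightarrow> (SUP x\<in>B. norm (u x)) \<le>
          C * (SUP x\<in>S. norm (u x)) powr \<alpha> * (SUP x\<in>D. norm (u x)) powr (1 - \<alpha>)"
      by blast
    have "compact (u ` cball p (\<rho> k))"
      using continuous_on_subset[OF cont[OF u] p(1)] by (intro compact_continuous_image) auto
    then have bdd: "bounded (u ` D)"
      using *(5) ball_subset_cball by (metis bounded_subset compact_imp_bounded image_mono subset_trans)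
    have "2 * ln C < \<alpha>\<^sup>2 * (2 * \<kappa> ^ k)"
      using k0[OF k] \<alpha> by (simp add: field_simps)
    from growth_from_interpolation[OF \<alpha> C this *(2,3,4) bdd _ *(1) p(2) ineq[OF bdd]] *(6)
    have "\<exists>q\<in>D. exp ((1 + \<alpha> / 2) * (2 * \<kappa> ^ k)) \<le> norm (u q)" by simp
    then show "\<exists>q\<in>ball p (\<rho> k). exp (2 * \<kappa> ^ Suc k) \<le> norm (u q)"
      using *(5) by (auto simp: \<kappa>_def[symmetric] mult_ac)
  qed
qed

section \<open>The slab estimate\<close>

lemma emeasure_lborel_box_of_sets:
  fixes X :: "'a::euclidean_space \<Rightarrow> real set"
  assumes [measurable]: "\<And>b. b \<in> Basis \<Longrightarrow> X b \<in> sets borel"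
  shows "emeasure lborel {x::'a. \<forall>b\<in>Basis. x \<bullet> b \<in> X b} = (\<Prod>b\<in>Basis. emeasure lborel (X b))"
proof -
  have [measurable]: "{x::'a. \<forall>b\<in>Basis. x \<bullet> b \<in> X b} \<in> sets borel"
    by measurable
  have "emeasure lborel {x::'a. \<forall>b\<in>Basis. x \<bullet> b \<in> X b}
      = (\<integral>\<^sup>+x. (\<Prod>b\<in>Basis. indicator (X b) (x \<bullet> b)) \<partial>lborel)"
  proof -
    have "indicator {x. \<forall>b\<in>Basis. x \<bullet> b \<in> X b} x = (\<Prod>b\<in>Basis. indicator (X b) (x \<bullet> b) :: ennreal)"
      for x :: 'a
    proof (cases "\<forall>b\<in>Basis. x \<bullet> b \<in> X b")
      case False
      then obtain b where "b \<in> Basis" "x \<bullet> b \<notin> X b" by blast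
      then have "(\<Prod>b\<in>Basis. indicator (X b) (x \<bullet> b) :: ennreal) = 0"
        by (intro prod_zero) (auto intro!: bexI[of _ b])
      then show ?thesis using False by simp
    qed simp
    note this[symmetric]
    then show ?thesis by simp
  qed
  also have "\<dots> = (\<Prod>b\<in>Basis. \<integral>\<^sup>+y. indicator (X b) y \<partial>lborel)"
    by (rule nn_integral_lborel_prod) auto
  finally show ?thesis by simp
qed

text \<open>The set E is enclosed in a Borel set of the same length; A is then contained in the product
  of this set with intervals of length 2r in the remaining directions.\<close>

lemma measure_slab_in_ball_le:
  fixes A :: "(real^'n::finite) set"
  assumes A: "A \<in> sets lebesgue" "A \<subseteq> ball p r" and E: "E \<in> lmeasurable"
    and AE: "\<And>x. x \<in> A \<Longrightarrow> x $ l \<in> E" and r: "0 \<le> r"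
  shows "measure lebesgue A \<le> (2 * r) ^ (CARD('n) - 1) * measure lebesgue E"
proof -
  have "E \<in> sets lebesgue" using E by auto
  then obtain E' where E': "E \<subseteq> E'" "E' \<in> sets borel" "emeasure lebesgue E = emeasure lborel E'"
    using completion_upper[of E lborel] by (metis sets_lborel)
  define X where "X = (\<lambda>b::real^'n. if b = axis l 1 then E' else {p \<bullet> b - r..p \<bullet> b + r})"
  have X[measurable]: "X b \<in> sets borel" for b using E' by (simp add: X_def)
  have ax: "axis l 1 \<in> (Basis :: (real^'n) set)" by simp
  have coord: "x \<bullet> b \<in> {p \<bullet> b - r..p \<bullet> b + r}" if "x \<in> A" "b \<in> Basis" for x b
  proof -
    have "\<bar>(p - x) \<bullet> b\<bar> \<le> norm (p - x)" using that by (simp add: Basis_le_norm)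
    also have "\<dots> < r" using that A by (auto simp: dist_norm)
    finally show ?thesis by (auto simp: inner_diff_left)
  qed
  have "A \<subseteq> {x. \<forall>b\<in>Basis. x \<bullet> b \<in> X b}"
    using coord AE E'(1) by (auto simp: X_def inner_axis)
  moreover have meas: "{x::real^'n. \<forall>b\<in>Basis. x \<bullet> b \<in> X b} \<in> sets borel"
    by measurable
  ultimately have "emeasure lebesgue A \<le> emeasure lebesgue {x. \<forall>b\<in>Basis. x \<bullet> b \<in> X b}"
    by (intro emeasure_mono) auto
  also have "\<dots> = emeasure lborel {x. \<forall>b\<in>Basis. x \<bullet> b \<in> X b}"
    using meas by simp
  also have "\<dots> = (\<Prod>b\<in>Basis. emeasure lborel (X b))"
    by (rule emeasure_lborel_box_of_sets) simp
  also have "\<dots> = emeasure lborel (X (axis l 1)) *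
      (\<Prod>b\<in>Basis - {axis l 1}. emeasure lborel (X b))"
    using ax by (intro prod.remove) auto
  also have "(\<Prod>b\<in>Basis - {axis l 1}. emeasure lborel (X b))
      = (\<Prod>b\<in>Basis - {axis l 1 :: real^'n}. ennreal (2 * r))"
    using r by (intro prod.cong) (auto simp: X_def)
  also have "\<dots> = ennreal ((2 * r) ^ (CARD('n) - 1))"
    using r ax by (simp add: card_Diff_singleton ennreal_power)
  also have "emeasure lborel (X (axis l 1)) = ennreal (measure lebesgue E)"
    using E E'(3) by (simp add: X_def emeasure_eq_measure2)
  finally have "emeasure lebesgue A \<le> ennreal ((2 * r) ^ (CARD('n) - 1) * measure lebesgue E)"
    using r by (simp add: ennreal_mult'[symmetric] mult.commute)
  then show ?thesis
    using r by (simp add: measure_def enn2real_leI)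
qed

section \<open>Wild sets\<close>

text \<open>The ball of radius r = rho/2 about p works: the part of it where the solution exceeds m lies
  over the superlevel set, so its volume is at most (2r)^(n-1) times the length of that set, and
  this is less than (1 - c) times the volume of the ball as soon as rho exceeds the length by
  the factor 2^n / ((1 - c) |B_1|).\<close>

lemma uniformly_bounded_of_SQUCP:
  fixes M :: "real \<Rightarrow> real" and \<Omega> :: "(real^'n::finite) set"
    and P :: "('n, 'k::euclidean_space) diff_operator"
  assumes M_meas: "M \<in> borel_measurable (lebesgue_on {-1<..<1})"
    and M_int: "(\<integral>\<^sup>+ y. ennreal (log_plus (log_plus (M y))) \<partial>lebesgue_on {-1<..<1}) < \<infinity>"
    and \<Omega>: "open \<Omega>" "\<Omega> \<subseteq> ball 0 1" and "SQUCP s P \<Omega>"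
  shows "uniformly_bounded_on_compacts \<Omega> (L_family s P \<Omega> l M)"
proof -
  obtain c C \<alpha> where c: "0 < c" "c < 1" and C: "C > 0" and \<alpha>: "0 < \<alpha>" "\<alpha> < 1" and
    wild: "\<And>p r S u. r > 0 \<Longrightarrow> ball p (2 * r) \<subseteq> \<Omega> \<Longrightarrow>
        S \<in> sets lebesgue \<Longrightarrow> S \<subseteq> ball p r \<Longrightarrow>
        measure lebesgue S > c * measure lebesgue (ball p r) \<Longrightarrow>
        solution s P \<Omega> u \<Longrightarrow> bounded (u ` ball p (2 * r)) \<Longrightarrow>
        (SUP x\<in>ball p r. norm (u x)) \<le>
          C * (SUP x\<in>S. norm (u x)) powr \<alpha> *
          (SUP x\<in>ball p (2 * r). norm (u x)) powr (1 - \<alpha>)"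
    using \<open>SQUCP s P \<Omega>\<close> unfolding SQUCP_def by metis
  define v where "v = measure lebesgue (ball (0::real^'n) 1)"
  have v: "v > 0" unfolding v_def by (simp add: content_ball_pos)
  define A where "A = 2 ^ CARD('n) / ((1 - c) * v)"
  have A: "A > 0" using c v by (simp add: A_def)
  show ?thesis
  proof (rule uniformly_bounded_if_interpolation_off_superlevel[OF \<Omega>(1) _ M_meas M_int \<alpha> C,
        where A = A])
    show "continuous_on \<Omega> u" if "u \<in> L_family s P \<Omega> l M" for u
      using that by (simp add: L_family_def solution_def)
    show "0 \<le> A" using A by simp
  next
    fix u p m \<rho>
    let ?E = "{y\<in>{-1<..<1}. m < M y}"
    assume u: "u \<in> L_family s P \<Omega> l M" and \<rho>: "A * measure lebesgue ?E < \<rho>"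
      and p: "cball p \<rho> \<subseteq> \<Omega>"
    have sol: "solution s P \<Omega> u" and maj: "\<And>z. z \<in> \<Omega> \<Longrightarrow> norm (u z) \<le> M (z $ l)"
      using u by (auto simp: L_family_def)
    have cont: "continuous_on \<Omega> u" using sol by (simp add: solution_def)
    define r where "r = \<rho> / 2"
    have "0 \<le> A * measure lebesgue ?E" using A by simp
    then have "0 < \<rho>" using \<rho> by (rule order_le_less_trans)
    then have r: "r > 0" "\<rho> = 2 * r" by (auto simp: r_def)
    have B2: "ball p (2 * r) \<subseteq> \<Omega>" using p r(2) ball_subset_cball by blast
    then have B\<Omega>: "ball p r \<subseteq> \<Omega>" using r(1) subset_ball[of r "2 * r" p] by auto
    define S where "S = {x\<in>ball p r. norm (u x) \<le> m}"
    have bad_open: "open (ball p r - S)"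
    proof -
      have "open {x\<in>ball p r. norm (u x) \<in> {m<..}}"
        using continuous_on_subset[OF cont B\<Omega>]
        by (intro continuous_open_preimage[unfolded vimage_def Int_def mem_Collect_eq]
            continuous_on_norm) auto
      moreover have "ball p r - S = {x\<in>ball p r. norm (u x) \<in> {m<..}}" by (auto simp: S_def)
      ultimately show ?thesis by simp
    qed
    have S_sets: "S \<in> sets lebesgue"
    proof -
      have "ball p r \<in> sets lebesgue" "ball p r - S \<in> sets lebesgue"
        using bad_open by (auto simp del: ball_eq_empty)
      then have "ball p r - (ball p r - S) \<in> sets lebesgue"
        by (rule sets.Diff)
      moreover have "ball p r - (ball p r - S) = S" by (auto simp: S_def)
      ultimately show ?thesis by simp
    qed
    have ball_v: "measure lebesgue (ball p r) = r ^ CARD('n) * v"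
      using r content_ball_conv_unit_ball[of r p] by (simp add: v_def)
    have "measure lebesgue (ball p r - S) \<le> (2 * r) ^ (CARD('n) - 1) * measure lebesgue ?E"
    proof (rule measure_slab_in_ball_le[of _ p _ _ l])
      show "?E \<in> lmeasurable" by (rule superlevel_in_lebesgue[OF M_meas])
      fix x assume "x \<in> ball p r - S"
      then have x: "x \<in> \<Omega>" "m < norm (u x)" using B\<Omega> by (auto simp: S_def)
      then have "norm x < 1" using \<Omega> by auto
      then have "\<bar>x $ l\<bar> < 1" using component_le_norm_cart[of x l] by simp
      then show "x $ l \<in> ?E" using x maj[of x] by auto
    qed (use bad_open r in auto)
    also have "\<dots> < (1 - c) * measure lebesgue (ball p r)"
    proof -
      have "A * ((1 - c) * v) * measure lebesgue ?E < 2 * r * ((1 - c) * v)"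
        using \<rho> c v r by (simp add: mult.assoc mult.left_commute[of _ "(1 - c) * v"])
      then have "2 ^ CARD('n) * measure lebesgue ?E < 2 * r * ((1 - c) * v)"
        using c v by (simp add: A_def)
      moreover have n: "CARD('n) = Suc (CARD('n) - 1)" by simp
      then have "2 ^ CARD('n) = 2 * (2::real) ^ (CARD('n) - 1)"
        "r ^ CARD('n) = r * r ^ (CARD('n) - 1)"
        by (metis power_Suc)+
      ultimately have "2 ^ (CARD('n) - 1) * measure lebesgue ?E < r * ((1 - c) * v)" by simp
      then have "r ^ (CARD('n) - 1) * (2 ^ (CARD('n) - 1) * measure lebesgue ?E)
          < r ^ (CARD('n) - 1) * (r * ((1 - c) * v))"
        using r by simp
      then show ?thesis
        unfolding ball_v \<open>r ^ CARD('n) = _\<close> by (simp add: power_mult_distrib mult_ac)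
    qed
    finally have less: "measure lebesgue (ball p r - S) < (1 - c) * measure lebesgue (ball p r)" .
    have "measure lebesgue (ball p r - S) = measure lebesgue (ball p r) - measure lebesgue S"
    proof (rule measure_Diff)
      show "emeasure lebesgue (ball p r) \<noteq> \<infinity>"
        using fmeasurableD2[OF lmeasurable_ball[of p r]] by simp
    qed (use S_sets in \<open>auto simp: S_def\<close>)
    with less have big: "c * measure lebesgue (ball p r) < measure lebesgue S"
      by (simp add: algebra_simps)
    moreover have "0 \<le> c * measure lebesgue (ball p r)" using c by simp
    ultimately have "S \<noteq> {}" by (intro notI) simp
    have SB: "S \<subseteq> ball p r" by (auto simp: S_def)
    show "\<exists>B S D. p \<in> B \<and> B \<subseteq> D \<and> S \<subseteq> D \<and> S \<noteq> {} \<and> D \<subseteq> ball p \<rho> \<and>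
        (\<forall>x\<in>S. norm (u x) \<le> m) \<and>
        (bounded (u ` D) \<longrightarrow> (SUP x\<in>B. norm (u x)) \<le>
          C * (SUP x\<in>S. norm (u x)) powr \<alpha> * (SUP x\<in>D. norm (u x)) powr (1 - \<alpha>))"
    proof (intro exI conjI)
      show "ball p r \<subseteq> ball p (2 * r)" using r(1) by (intro subset_ball) simp
      then show "S \<subseteq> ball p (2 * r)" using SB by blast
      show "\<forall>x\<in>S. norm (u x) \<le> m" by (simp add: S_def)
      show "bounded (u ` ball p (2 * r)) \<longrightarrow> (SUP x\<in>ball p r. norm (u x)) \<le>
          C * (SUP x\<in>S. norm (u x)) powr \<alpha> * (SUP x\<in>ball p (2 * r). norm (u x)) powr (1 - \<alpha>)"
        using wild[OF r(1) B2 S_sets SB big sol] by blast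
    qed (use r \<open>S \<noteq> {}\<close> in auto)
  qed
qed

section \<open>Symmetric decreasing majorants\<close>

lemma symmetric_decreasing_le_off_superlevel_length:
  fixes M :: "real \<Rightarrow> real"
  assumes M_meas: "M \<in> borel_measurable (lebesgue_on {-1<..<1})"
    and sym: "\<And>y. y \<in> {-1<..<1} \<Longrightarrow> M y = M \<bar>y\<bar>" and anti: "antimono_on {0<..<1} M"
    and y: "y \<in> {-1<..<1}" "measure lebesgue {y\<in>{-1<..<1}. m < M y} < \<bar>y\<bar>"
  shows "M y \<le> m"
proof (rule ccontr)
  assume "\<not> M y \<le> m"
  have "0 < \<bar>y\<bar>" using y(2) measure_nonneg by (metis order_le_less_trans)
  have "{0<..<\<bar>y\<bar>} \<subseteq> {y\<in>{-1<..<1}. m < M y}"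
  proof
    fix t assume t: "t \<in> {0<..<\<bar>y\<bar>}"
    then have "M \<bar>y\<bar> \<le> M t" using y(1) by (intro monotone_onD[OF anti]) auto
    then show "t \<in> {y\<in>{-1<..<1}. m < M y}" using t y(1) sym[OF y(1)] \<open>\<not> M y \<le> m\<close> by auto
  qed
  then have "measure lebesgue {0<..<\<bar>y\<bar>} \<le> measure lebesgue {y\<in>{-1<..<1}. m < M y}"
    using superlevel_in_lebesgue(2)[OF M_meas] by (intro measure_mono_fmeasurable) auto
  then show False using y(2) \<open>0 < \<bar>y\<bar>\<close> by simp
qed

text \<open>Shifting the centre by 3/4 of the radius, away from the hyperplane of height 0, keeps p in the
  ball of radius r and lifts the half ball above height 3r/4 - r/2 = r/4.\<close>

lemma uniformly_bounded_of_three_balls_inequality: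
  fixes M :: "real \<Rightarrow> real" and \<Omega> :: "(real^'n::finite) set"
    and P :: "('n, 'k::euclidean_space) diff_operator"
  assumes M_meas: "M \<in> borel_measurable (lebesgue_on {-1<..<1})"
    and M_int: "(\<integral>\<^sup>+ y. ennreal (log_plus (log_plus (M y))) \<partial>lebesgue_on {-1<..<1}) < \<infinity>"
    and \<Omega>: "open \<Omega>" "\<Omega> \<subseteq> ball 0 1" and "three_balls_inequality s P \<Omega>"
    and sym: "\<And>y. y \<in> {-1<..<1} \<Longrightarrow> M y = M \<bar>y\<bar>" and anti: "antimono_on {0<..<1} M"
  shows "uniformly_bounded_on_compacts \<Omega> (L_family s P \<Omega> l M)"
proof -
  obtain C \<alpha> where C: "C > 0" and \<alpha>: "0 < \<alpha>" "\<alpha> < 1" and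
    three: "\<And>p r u. r > 0 \<Longrightarrow> ball p (2 * r) \<subseteq> \<Omega> \<Longrightarrow>
        solution s P \<Omega> u \<Longrightarrow> bounded (u ` ball p (2 * r)) \<Longrightarrow>
        (SUP x\<in>ball p r. norm (u x)) \<le>
          C * (SUP x\<in>ball p (r / 2). norm (u x)) powr \<alpha> *
          (SUP x\<in>ball p (2 * r). norm (u x)) powr (1 - \<alpha>)"
    using \<open>three_balls_inequality s P \<Omega>\<close> unfolding three_balls_inequality_def by metis
  show ?thesis
  \<comment> \<open>The double ball lies in the ball of radius 3r about p, so rho = 3r, and r/4 must exceed the
    length of the superlevel set.\<close>
  proof (rule uniformly_bounded_if_interpolation_off_superlevel[OF \<Omega>(1) _ M_meas M_int \<alpha> C,
        where A = 12])
    show "continuous_on \<Omega> u" if "u \<in> L_family s P \<Omega> l M" for u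
      using that by (simp add: L_family_def solution_def)
    show "(0::real) \<le> 12" by simp
  next
    fix u p m \<rho>
    let ?E = "{y\<in>{-1<..<1}. m < M y}"
    assume u: "u \<in> L_family s P \<Omega> l M" and \<rho>: "12 * measure lebesgue ?E < \<rho>"
      and p: "cball p \<rho> \<subseteq> \<Omega>"
    have sol: "solution s P \<Omega> u" and maj: "\<And>z. z \<in> \<Omega> \<Longrightarrow> norm (u z) \<le> M (z $ l)"
      using u by (auto simp: L_family_def)
    define r where "r = \<rho> / 3"
    have "0 \<le> 12 * measure lebesgue ?E" by simp
    then have "0 < \<rho>" using \<rho> by (rule order_le_less_trans)
    then have r: "r > 0" "\<rho> = 3 * r" by (auto simp: r_def)
    define \<sigma> :: real where "\<sigma> = (if 0 \<le> p $ l then 1 else -1)"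
    define q where "q = p + (\<sigma> * (3 / 4 * r)) *\<^sub>R axis l 1"
    have pq: "dist p q = 3 / 4 * r"
      using r by (simp add: q_def dist_norm \<sigma>_def)
    have D: "ball q (2 * r) \<subseteq> ball p \<rho>"
    proof
      fix x assume "x \<in> ball q (2 * r)"
      then show "x \<in> ball p \<rho>" using dist_triangle[of p x q] pq r by simp
    qed
    have D\<Omega>: "ball q (2 * r) \<subseteq> \<Omega>" using D p ball_subset_cball by blast
    have small: "norm (u x) \<le> m" if x: "x \<in> ball q (r / 2)" for x
    proof -
      have "x \<in> ball q (2 * r)" using x r by auto
      then have x\<Omega>: "x \<in> \<Omega>" using D\<Omega> by blast
      then have "norm x < 1" using \<Omega> by auto
      then have x1: "\<bar>x $ l\<bar> < 1" using component_le_norm_cart[of x l] by simp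
      have "\<bar>q $ l - x $ l\<bar> < r / 2"
        using x component_le_norm_cart[of "q - x" l] by (simp add: dist_norm)
      moreover have "q $ l = p $ l + \<sigma> * (3 / 4 * r)" by (simp add: q_def)
      ultimately have "\<bar>p $ l + \<sigma> * (3 / 4 * r) - x $ l\<bar> < r / 2" by simp
      then have "r / 4 < \<bar>x $ l\<bar>"
        unfolding \<sigma>_def abs_less_iff by (cases "0 \<le> p $ l") (auto simp: abs_if)
      then have "M (x $ l) \<le> m"
        using x1 \<rho> r
        by (intro symmetric_decreasing_le_off_superlevel_length[OF M_meas sym anti]) auto
      then show ?thesis using maj[OF x\<Omega>] by simp
    qed
    show "\<exists>B S D. p \<in> B \<and> B \<subseteq> D \<and> S \<subseteq> D \<and> S \<noteq> {} \<and> D \<subseteq> ball p \<rho> \<and>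
        (\<forall>x\<in>S. norm (u x) \<le> m) \<and>
        (bounded (u ` D) \<longrightarrow> (SUP x\<in>B. norm (u x)) \<le>
          C * (SUP x\<in>S. norm (u x)) powr \<alpha> * (SUP x\<in>D. norm (u x)) powr (1 - \<alpha>))"
    proof (intro exI conjI)
      show "p \<in> ball q r" using pq r by (simp add: dist_commute)
      show "\<forall>x\<in>ball q (r / 2). norm (u x) \<le> m" using small by blast
      show "bounded (u ` ball q (2 * r)) \<longrightarrow> (SUP x\<in>ball q r. norm (u x)) \<le>
          C * (SUP x\<in>ball q (r / 2). norm (u x)) powr \<alpha> *
          (SUP x\<in>ball q (2 * r). norm (u x)) powr (1 - \<alpha>)"
        using three[OF r(1) D\<Omega> sol] by blast
      show "ball q (r / 2) \<subseteq> ball q (2 * r)" "ball q r \<subseteq> ball q (2 * r)"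
        using r(1) by (auto intro: subset_ball)
    qed (use D r in auto)
  qed
qed

theorem theorem3p1:
  fixes M :: "real \<Rightarrow> real"
    and \<Omega> :: "(real^'n::finite) set"
    and l :: 'n
    and P :: "('n, 'k::{real_normed_field, euclidean_space}) diff_operator"
    and s :: solution_sense
  assumes M_pos: "\<And>y. y \<in> {-1<..<1} \<Longrightarrow> M y > 0"
    and M_meas: "M \<in> borel_measurable (lebesgue_on {-1<..<1})"
    and M_int: "(\<integral>\<^sup>+ y. ennreal (log_plus (log_plus (M y))) \<partial>lebesgue_on {-1<..<1}) < \<infinity>"
    and dom: "domain \<Omega>" "\<Omega> \<subseteq> ball 0 1"
  shows "(SQUCP s P \<Omega> \<longrightarrow> uniformly_bounded_on_compacts \<Omega> (L_family s P \<Omega> l M)) \<and>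
    (three_balls_inequality s P \<Omega> \<and> (\<forall>y\<in>{-1<..<1}. M y = M \<bar>y\<bar>) \<and> antimono_on {0<..<1} M
       \<longrightarrow> uniformly_bounded_on_compacts \<Omega> (L_family s P \<Omega> l M))"
proof -
  have "open \<Omega>" using dom(1) by (simp add: domain_def)
  then show ?thesis
    using uniformly_bounded_of_SQUCP[OF M_meas M_int _ dom(2)]
      uniformly_bounded_of_three_balls_inequality[OF M_meas M_int _ dom(2)] by blast
qed

end
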